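(* For $X=[(\underline{x}_L,\overline{x}_L),(\underline{x}_U,\overline{x}_U)]$ and $Y=[(\underline{y}_L,\overline{y}_L),(\underline{y}_U,\overline{y}_U)]$ in $I_2(\mathbb{R})$, let $$D_{M_2}(X,Y)=\max\{|\underline{x}_L-\underline{y}_L|,\ |\overline{x}_L-\overline{y}_L|,\ |\underline{x}_U-\underline{y}_U|,\ |\overline{x}_U-\overline{y}_U|\}.$$ Then $D_{M_2}$ (the extended Moore distance) is a metric on $I_2(\mathbb{R})$.
   Context: A Type-2 interval is given by four real numbers $\underline{a}_L\le\overline{a}_L\le\underline{a}_U\le\overline{a}_U$ and is written $A=[(\underline{a}_L,\overline{a}_L),(\underline{a}_U,\overline{a}_U)]$; it represents the intervals $[a_L,a_U]$ with $a_L\in[\underline{a}_L,\overline{a}_L]$ and $a_U\in[\underline{a}_U,\overline{a}_U]$. $I_2(\mathbb{R})$ denotes the set of all Type-2 intervals. Two Type-2 intervals are equal if and only if their four corresponding entries are equal. *)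

theory Defs
  imports "HOL-Analysis.Abstract_Metric_Spaces"
begin

text \<open>
  The quadruple \<open>T2 a b c d\<close> stands for \<open>[(a, b), (c, d)]\<close>; the prefixes \<open>lo\<close> and \<open>up\<close> are the
  underline and overline of the source notation. Such a quadruple is a Type-2 interval only if it
  lies in \<open>I2\<close> below.
\<close>

datatype t2_quad = T2 (lo_L: real) (up_L: real) (lo_U: real) (up_U: real)

definition I2 :: "t2_quad set" where
  "I2 = {A. lo_L A \<le> up_L A \<and> up_L A \<le> lo_U A \<and> lo_U A \<le> up_U A}"

definition D_M2 :: "t2_quad \<Rightarrow> t2_quad \<Rightarrow> real" where
  "D_M2 X Y = Max {\<bar>lo_L X - lo_L Y\<bar>, \<bar>up_L X - up_L Y\<bar>,
                   \<bar>lo_U X - lo_U Y\<bar>, \<bar>up_U X - up_U Y\<bar>}"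

end

theory Submission
  imports Defs
begin

text \<open>\<open>D_M2\<close> is the sup-norm distance between the entries, viewed as points of
  the four-dimensional real space. By \<open>D_M2_le_iff\<close>, bounding it means bounding every
  coordinate difference, so each axiom reduces to properties of the absolute value on the reals. The
  axioms are proved for all quadruples and restrict to the subset \<open>I2\<close>.\<close>

lemma D_M2_le_iff:
  "D_M2 X Y \<le> r \<longleftrightarrow>
    \<bar>lo_L X - lo_L Y\<bar> \<le> r \<and> \<bar>up_L X - up_L Y\<bar> \<le> r \<and>
    \<bar>lo_U X - lo_U Y\<bar> \<le> r \<and> \<bar>up_U X - up_U Y\<bar> \<le> r"
  by (simp add: D_M2_def)

lemma D_M2_nonneg: "0 \<le> D_M2 X Y"
proof -
  have "\<bar>lo_L X - lo_L Y\<bar> \<le> D_M2 X Y"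
    using D_M2_le_iff by blast
  then show ?thesis
    using abs_ge_zero order_trans by blast
qed

lemma D_M2_commute: "D_M2 X Y = D_M2 Y X"
  by (simp add: D_M2_def abs_minus_commute)

lemma D_M2_eq_0_iff: "D_M2 X Y = 0 \<longleftrightarrow> X = Y"
proof -
  \<comment> \<open>Nonnegativity turns the equation into an upper bound, which
    \<open>D_M2_le_iff\<close> splits by coordinates.\<close>
  have "D_M2 X Y = 0 \<longleftrightarrow> D_M2 X Y \<le> 0"
    using D_M2_nonneg[of X Y] by linarith
  also have "\<dots> \<longleftrightarrow> X = Y"
    by (cases X; cases Y) (simp add: D_M2_le_iff)
  finally show ?thesis .
qed

lemma D_M2_triangle: "D_M2 X Z \<le> D_M2 X Y + D_M2 Y Z"
proof -
  have step: "\<bar>a - c\<bar> \<le> r + s" if "\<bar>a - b\<bar> \<le> r" "\<bar>b - c\<bar> \<le> s" for a b c r s :: real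
    using that by linarith
  \<comment> \<open>Through \<open>D_M2_le_iff\<close>, these trivial bounds say that each
    coordinate difference is at most the distance; \<open>step\<close> then adds them in each
    coordinate.\<close>
  have "D_M2 X Y \<le> D_M2 X Y" "D_M2 Y Z \<le> D_M2 Y Z"
    by simp_all
  then show ?thesis
    unfolding D_M2_le_iff[of X Z] by (meson D_M2_le_iff step)
qed

theorem theorem5p1: "Metric_space I2 D_M2"
  by (intro Metric_space.intro D_M2_nonneg D_M2_commute D_M2_eq_0_iff D_M2_triangle)

end
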